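(* Let $n\ge1$ and let $D$ be either $\{(i,j):1\le i,j\le n,\ i+j\le n+1\}$ or $\{(i,j):1\le i,j\le n,\ i+j\ge n+1\}$ (a staircase grid of size $n$ whose diagonal runs from top-left to bottom-right). Then the downcore graph of $D$ is pure, and every maximal independent set of it has exactly $2n-1$ elements.
   Context: Boxes $(i,j)$ are indexed by column $i$ (from the left) and row $j$ (from the bottom). The downcore graph of a set $D$ of boxes has vertex set $D$, with an edge between $(i,j)$ and $(k,\ell)$ if and only if ($i<k$ and $j>\ell$, or $i>k$ and $j<\ell$) and both $(i,\ell)$ and $(k,j)$ belong to $D$. A graph is pure if all its maximal (with respect to inclusion) independent sets have the same size. *)

theory Defs
  imports Main
begin

text \<open>A simple graph is a pair of its vertex set and its set of edges, each edge being the
  unordered pair (two-element set) of its ends.\<close>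

type_synonym 'a graph = "'a set \<times> 'a set set"

definition independent_set :: "'a graph \<Rightarrow> 'a set \<Rightarrow> bool" where
  "independent_set G S \<longleftrightarrow> S \<subseteq> fst G \<and> (\<forall>u\<in>S. \<forall>v\<in>S. {u, v} \<notin> snd G)"

definition maximal_independent_set :: "'a graph \<Rightarrow> 'a set \<Rightarrow> bool" where
  "maximal_independent_set G S \<longleftrightarrow>
     independent_set G S \<and> (\<forall>T. independent_set G T \<and> S \<subseteq> T \<longrightarrow> T = S)"

text \<open>Size is \<^const>\<open>card\<close>, so this is the intended notion only for finite graphs.\<close>

definition pure_graph :: "'a graph \<Rightarrow> bool" where
  "pure_graph G \<longleftrightarrow>
     (\<forall>S T. maximal_independent_set G S \<and> maximal_independent_set G T \<longrightarrow> card S = card T)"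

text \<open>A box \<open>(i, j)\<close> lies in column \<open>i\<close> from the left and row \<open>j\<close> from the bottom.\<close>

type_synonym box = "nat \<times> nat"

definition downcore_graph :: "box set \<Rightarrow> box graph" where
  "downcore_graph D =
     (D, {{(i, j), (k, l)} | i j k l.
            (i, j) \<in> D \<and> (k, l) \<in> D \<and>
            (i < k \<and> j > l \<or> i > k \<and> j < l) \<and>
            (i, l) \<in> D \<and> (k, j) \<in> D})"

definition lower_staircase :: "nat \<Rightarrow> box set" where
  "lower_staircase n = {(i, j). 1 \<le> i \<and> i \<le> n \<and> 1 \<le> j \<and> j \<le> n \<and> i + j \<le> n + 1}"

definition upper_staircase :: "nat \<Rightarrow> box set" where
  "upper_staircase n = {(i, j). 1 \<le> i \<and> i \<le> n \<and> 1 \<le> j \<and> j \<le> n \<and> i + j \<ge> n + 1}"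

end

theory Submission
  imports Defs
begin

text \<open>Reading a box of a staircase of size \<open>n\<close> as an arc between two points of \<open>{1..n + 1}\<close>
  turns adjacency in the downcore graph into crossing of arcs. The maximal independent sets are then
  the triangulations of a convex \<open>(n + 1)\<close>-gon, sides included. Such a triangulation is cut by the
  triangle resting on the arc \<open>(a, b)\<close>, with apex \<open>c\<close>, into triangulations of \<open>{a..c}\<close> and
  \<open>{c..b}\<close>, so it has \<open>2 * (b - a) - 1\<close> arcs by induction.\<close>

text \<open>A vertex outside \<open>S\<close> with no neighbour in \<open>S\<close> could be
  inserted, since without loops \<open>insert u S\<close> stays independent. The quantifier over
  larger sets \<open>T\<close> thus becomes a fixed-point equation, which passes to images under
  bijections and to parts of \<open>S\<close>.\<close>

lemma maximal_independent_set_iff: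
  assumes "\<And>u. {u} \<notin> snd G"
  shows "maximal_independent_set G S \<longleftrightarrow> S = {u \<in> fst G. \<forall>v\<in>S. {u, v} \<notin> snd G}"
proof
  assume max: "maximal_independent_set G S"
  then have ind: "independent_set G S"
    by (simp add: maximal_independent_set_def)
  have "u \<in> S" if "u \<in> fst G" "\<forall>v\<in>S. {u, v} \<notin> snd G" for u
  proof -
    have "independent_set G (insert u S)"
      using ind that assms by (auto simp: independent_set_def insert_commute)
    then have "insert u S = S"
      using max by (auto simp: maximal_independent_set_def)
    then show ?thesis by blast
  qed
  then show "S = {u \<in> fst G. \<forall>v\<in>S. {u, v} \<notin> snd G}"
    using ind by (auto simp: independent_set_def)
next
  assume eq: "S = {u \<in> fst G. \<forall>v\<in>S. {u, v} \<notin> snd G}"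
  have "T \<subseteq> S" if "independent_set G T" "S \<subseteq> T" for T
    using that by (subst eq) (auto simp: independent_set_def)
  moreover have "independent_set G S"
    using eq unfolding independent_set_def by blast
  ultimately show "maximal_independent_set G S"
    by (auto simp: maximal_independent_set_def)
qed

definition arcs :: "nat \<Rightarrow> nat \<Rightarrow> (nat \<times> nat) set" where
  "arcs a b = {(x, y). a \<le> x \<and> x < y \<and> y \<le> b}"

text \<open>All inequalities are strict, so arcs with a common end do not cross.\<close>

definition crossing :: "nat \<times> nat \<Rightarrow> nat \<times> nat \<Rightarrow> bool" where
  "crossing u v \<longleftrightarrow>
     fst u < fst v \<and> fst v < snd u \<and> snd u < snd v \<or>
     fst v < fst u \<and> fst u < snd v \<and> snd v < snd u"

lemma finite_arcs: "finite (arcs a b)"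
  by (rule finite_subset[of _ "{..b} \<times> {..b}"]) (auto simp: arcs_def)

lemma card_maximal_noncrossing:
  assumes "a < b" and "S = {u \<in> arcs a b. \<forall>v\<in>S. \<not> crossing u v}"
  shows "card S = 2 * (b - a) - 1"
  using assms
proof (induction "b - a" arbitrary: a b S rule: less_induct)
  case less
  note eq = less.prems(2)
  have sub: "S \<subseteq> arcs a b" and noncross: "\<And>u v. u \<in> S \<Longrightarrow> v \<in> S \<Longrightarrow> \<not> crossing u v"
    and maxi: "\<And>u. u \<in> arcs a b \<Longrightarrow> \<forall>v\<in>S. \<not> crossing u v \<Longrightarrow> u \<in> S"
    using eq by blast+
  have ab: "(a, b) \<in> S"
    using sub less.prems(1) by (intro maxi) (auto simp: arcs_def crossing_def)
  show ?case
  proof (cases "b = Suc a")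
    case True
    then have "S = {(a, b)}"
      using ab sub by (auto simp: arcs_def)
    then show ?thesis using True by simp
  next
    case False
    \<comment> \<open>No point lies strictly between the ends, so nothing crosses this side; it
      makes \<open>C\<close> nonempty.\<close>
    have "(a, Suc a) \<in> S"
      using sub less.prems(1) by (intro maxi) (auto simp: arcs_def crossing_def)
    \<comment> \<open>The apex \<open>c\<close> is the farthest point joined to \<open>a\<close>
      other than \<open>b\<close> itself.\<close>
    define C where "C = {c. c < b \<and> (a, c) \<in> S}"
    define c where "c = Max C"
    have "finite C" by (simp add: C_def)
    moreover have "Suc a \<in> C"
      using \<open>(a, Suc a) \<in> S\<close> False less.prems(1) by (auto simp: C_def)
    ultimately have "c \<in> C" and c_max: "\<And>d. d \<in> C \<Longrightarrow> d \<le> c"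
      unfolding c_def by (auto intro: Max_in)
    then have c: "c < b" "(a, c) \<in> S" by (auto simp: C_def)
    then have "a < c" using sub by (auto simp: arcs_def)
    \<comment> \<open>An arc of \<open>S\<close> crossing \<open>(c, b)\<close> starts before
      \<open>c\<close> and ends strictly between \<open>c\<close> and \<open>b\<close>. If it starts
      at \<open>a\<close>, it contradicts the choice of \<open>c\<close>; otherwise it crosses
      \<open>(a, c)\<close>.\<close>
    have cb: "(c, b) \<in> S"
    proof (intro maxi ballI notI)
      show "(c, b) \<in> arcs a b" using \<open>a < c\<close> \<open>c < b\<close> by (auto simp: arcs_def)
    next
      fix v assume v: "v \<in> S" "crossing (c, b) v"
      obtain x y where "v = (x, y)" by force
      with v sub have xy: "a \<le> x" "x < c" "c < y" "y < b" by (auto simp: crossing_def arcs_def)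
      show False
      proof (cases "x = a")
        case True
        then have "y \<in> C" using v xy \<open>v = (x, y)\<close> by (simp add: C_def)
        then show False using c_max xy by fastforce
      next
        case False
        then have "crossing (a, c) v" using xy \<open>v = (x, y)\<close> by (simp add: crossing_def)
        then show False using noncross c v by blast
      qed
    qed
    define L where "L = S \<inter> arcs a c"
    define R where "R = S \<inter> arcs c b"
    \<comment> \<open>By the same two cases, the only arc of \<open>S\<close> passing strictly over
      \<open>c\<close> is \<open>(a, b)\<close>.\<close>
    have split: "S = insert (a, b) (L \<union> R)"
    proof
      show "S \<subseteq> insert (a, b) (L \<union> R)"
      proof
        fix u assume u: "u \<in> S"
        obtain x y where xy: "u = (x, y)" by force
        have "\<not> crossing (a, c) u" "\<not> crossing (c, b) u" using noncross u c cb by blast+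
        moreover have "x = a \<Longrightarrow> y < b \<Longrightarrow> y \<le> c" using c_max u xy by (simp add: C_def)
        moreover have "a \<le> x" "x < y" "y \<le> b" using sub u xy by (auto simp: arcs_def)
        ultimately show "u \<in> insert (a, b) (L \<union> R)"
          using u \<open>a < c\<close> \<open>c < b\<close> unfolding xy L_def R_def crossing_def arcs_def by auto
      qed
    qed (use ab in \<open>auto simp: L_def R_def\<close>)
    have maxL: "L = {u \<in> arcs a c. \<forall>v\<in>L. \<not> crossing u v}"
    proof
      show "{u \<in> arcs a c. \<forall>v\<in>L. \<not> crossing u v} \<subseteq> L"
      proof
        fix u assume "u \<in> {u \<in> arcs a c. \<forall>v\<in>L. \<not> crossing u v}"
        then have u: "u \<in> arcs a c" "\<forall>v\<in>L. \<not> crossing u v" by auto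
        \<comment> \<open>An arc inside \<open>{a..c}\<close> can only be obstructed by arcs of
          \<open>L\<close>, so \<open>L\<close> inherits maximality from \<open>S\<close>.\<close>
        have "\<not> crossing u v" if "v \<in> insert (a, b) R" for v
          using u(1) that \<open>c < b\<close> by (auto simp: R_def crossing_def arcs_def)
        then have "u \<in> S"
          using u \<open>c < b\<close> by (intro maxi, force simp: arcs_def) (auto simp: split)
        then show "u \<in> L" using u by (simp add: L_def)
      qed
    qed (use noncross in \<open>auto simp: L_def\<close>)
    have maxR: "R = {u \<in> arcs c b. \<forall>v\<in>R. \<not> crossing u v}"
    proof
      show "{u \<in> arcs c b. \<forall>v\<in>R. \<not> crossing u v} \<subseteq> R"
      proof
        fix u assume "u \<in> {u \<in> arcs c b. \<forall>v\<in>R. \<not> crossing u v}"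
        then have u: "u \<in> arcs c b" "\<forall>v\<in>R. \<not> crossing u v" by auto
        have "\<not> crossing u v" if "v \<in> insert (a, b) L" for v
          using u(1) that \<open>a < c\<close> by (auto simp: L_def crossing_def arcs_def)
        then have "u \<in> S"
          using u \<open>a < c\<close> by (intro maxi, force simp: arcs_def) (auto simp: split)
        then show "u \<in> R" using u by (simp add: R_def)
      qed
    qed (use noncross in \<open>auto simp: R_def\<close>)
    have "card L = 2 * (c - a) - 1"
      using less.hyps[of c a L] maxL \<open>a < c\<close> \<open>c < b\<close> by simp
    moreover have "card R = 2 * (b - c) - 1"
      using less.hyps[of b c R] maxR \<open>a < c\<close> \<open>c < b\<close> by simp
    moreover have "finite L" "finite R" by (simp_all add: L_def R_def finite_arcs)
    moreover have "L \<inter> R = {}" "(a, b) \<notin> L \<union> R"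
      using \<open>a < c\<close> \<open>c < b\<close> by (auto simp: L_def R_def arcs_def)
    ultimately have "card S = Suc (2 * (c - a) - 1 + (2 * (b - c) - 1))"
      by (simp add: split card_Un_disjoint)
    then show ?thesis using \<open>a < c\<close> \<open>c < b\<close> by simp
  qed
qed

lemma card_maximal_independent_set_arc_model:
  assumes "bij_betw f (fst G) (arcs a b)" and "a < b"
    and edge: "\<And>u v. u \<in> fst G \<Longrightarrow> v \<in> fst G \<Longrightarrow> {u, v} \<in> snd G \<longleftrightarrow> crossing (f u) (f v)"
    and loopless: "\<And>u. {u} \<notin> snd G"
    and max: "maximal_independent_set G S"
  shows "card S = 2 * (b - a) - 1"
proof -
  have inj: "inj_on f (fst G)" and img: "f ` fst G = arcs a b"
    using assms(1) by (auto simp: bij_betw_def)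
  have eq: "S = {u \<in> fst G. \<forall>v\<in>S. {u, v} \<notin> snd G}"
    using max maximal_independent_set_iff[OF loopless] by blast
  then have sub: "S \<subseteq> fst G" by blast
  have "S = {u \<in> fst G. \<forall>v\<in>S. \<not> crossing (f u) (f v)}"
    using eq sub edge by blast
  then have "f ` S = {u \<in> arcs a b. \<forall>v\<in>f ` S. \<not> crossing u v}"
    unfolding img[symmetric] by blast
  then have "card (f ` S) = 2 * (b - a) - 1"
    by (rule card_maximal_noncrossing[OF \<open>a < b\<close>])
  then show ?thesis
    using card_image[OF inj_on_subset[OF inj sub]] by simp
qed

text \<open>The condition is symmetric in the two boxes, so it does not matter in which order the
  unordered pair is read.\<close>

lemma downcore_graph_edge_iff:
  "{(i, j), (k, l)} \<in> snd (downcore_graph D) \<longleftrightarrow>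
     (i, j) \<in> D \<and> (k, l) \<in> D \<and> (i < k \<and> j > l \<or> i > k \<and> j < l) \<and> (i, l) \<in> D \<and> (k, j) \<in> D"
  by (auto simp: downcore_graph_def doubleton_eq_iff)

lemma downcore_graph_loopless: "{u} \<notin> snd (downcore_graph D)"
  by (cases u) (use downcore_graph_edge_iff[of "fst u" "snd u" "fst u" "snd u" D] in auto)

lemma card_maximal_independent_lower_staircase:
  assumes "n \<ge> 1" "maximal_independent_set (downcore_graph (lower_staircase n)) S"
  shows "card S = 2 * n - 1"
proof -
  \<comment> \<open>\<open>i + j \<le> n + 1\<close> says exactly that \<open>i < n + 2 - j\<close>.
    For \<open>i < k\<close> and \<open>j > l\<close>, the corner \<open>(i, l)\<close> is
    automatically in the staircase, and \<open>(k, j)\<close> is in it iff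
    \<open>k < n + 2 - j\<close>, the middle inequality of a crossing.\<close>
  let ?f = "\<lambda>(i, j). (i, n + 2 - j)"
  have "bij_betw ?f (lower_staircase n) (arcs 1 (n + 1))"
    by (rule bij_betw_byWitness[where f' = ?f]) (auto simp: lower_staircase_def arcs_def)
  moreover have "{u, v} \<in> snd (downcore_graph (lower_staircase n)) \<longleftrightarrow> crossing (?f u) (?f v)"
    if "u \<in> lower_staircase n" "v \<in> lower_staircase n" for u v
    using that
    by (cases u; cases v) (auto simp: downcore_graph_edge_iff lower_staircase_def crossing_def)
  ultimately show ?thesis
    using card_maximal_independent_set_arc_model[of ?f "downcore_graph (lower_staircase n)"
        1 "n + 1" S] assms downcore_graph_loopless
    by (simp add: downcore_graph_def)
qed

lemma card_maximal_independent_upper_staircase: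
  assumes "n \<ge> 1" "maximal_independent_set (downcore_graph (upper_staircase n)) S"
  shows "card S = 2 * n - 1"
proof -
  \<comment> \<open>The shift to \<open>i + 1\<close> makes \<open>n + 1 - j \<le> i\<close> strict.
    Now \<open>(k, j)\<close> is the automatic corner when \<open>i < k\<close> and
    \<open>j > l\<close>, and \<open>(i, l)\<close> is in the staircase iff
    \<open>n + 1 - l < i + 1\<close>.\<close>
  let ?f = "\<lambda>(i, j). (n + 1 - j, i + 1)"
  let ?g = "\<lambda>(x, y). (y - 1, n + 1 - x)"
  have "bij_betw ?f (upper_staircase n) (arcs 1 (n + 1))"
    by (rule bij_betw_byWitness[where f' = ?g]) (auto simp: upper_staircase_def arcs_def)
  moreover have "{u, v} \<in> snd (downcore_graph (upper_staircase n)) \<longleftrightarrow> crossing (?f u) (?f v)"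
    if "u \<in> upper_staircase n" "v \<in> upper_staircase n" for u v
    using that
    by (cases u; cases v) (auto simp: downcore_graph_edge_iff upper_staircase_def crossing_def)
  ultimately show ?thesis
    using card_maximal_independent_set_arc_model[of ?f "downcore_graph (upper_staircase n)"
        1 "n + 1" S] assms downcore_graph_loopless
    by (simp add: downcore_graph_def)
qed

theorem theorem3p13:
  fixes n :: nat and D :: "box set"
  assumes "n \<ge> 1"
    and "D = lower_staircase n \<or> D = upper_staircase n"
  shows "pure_graph (downcore_graph D) \<and>
    (\<forall>S. maximal_independent_set (downcore_graph D) S \<longrightarrow> card S = 2 * n - 1)"
proof -
  have "card S = 2 * n - 1" if "maximal_independent_set (downcore_graph D) S" for S
    using assms that card_maximal_independent_lower_staircase
      card_maximal_independent_upper_staircase by blast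
  then show ?thesis by (simp add: pure_graph_def)
qed

end
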